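(* Let $\mathcal{R}$ be a commutative Frobenius ring, let $\lambda\in\mathcal{R}$, let $n\ge 1$, and let $R$ denote the $n\times n$ back diagonal $(0,1)$-matrix. Let $A,B,C,D$ be $n\times n$ $\lambda$-circulant matrices over $\mathcal{R}$ satisfying $$AA^{T}+BB^{T}+CC^{T}+DD^{T}=-I_{n}\quad\text{and}\quad AB^{T}-BA^{T}-CD^{T}+DC^{T}=0.$$ Let $\mathcal{C}$ be the linear code over $\mathcal{R}$ of length $8n$ generated by the rows of the $4n\times 8n$ matrix $$G=\left(\; I_{4n}\;\begin{array}{|cccc} A & B & CR & DR \\ -B & A & DR & -CR \\ -CR & -DR & A & B \\ -DR & CR & -B & A\end{array}\right).$$ Then $\mathcal{C}$ is self-dual.
   Context: A linear code of length $m$ over a commutative Frobenius ring $\mathcal{R}$ is an $\mathcal{R}$-submodule of $\mathcal{R}^{m}$. The Euclidean inner product is $\langle x,y\rangle_E=\sum_i x_iy_i$, the dual code is $\mathcal{C}^{\perp}=\{x\in\mathcal{R}^{m}\mid \langle x,y\rangle_E=0 \text{ for all } y\in\mathcal{C}\}$, and $\mathcal{C}$ is self-dual if $\mathcal{C}=\mathcal{C}^{\perp}$. For $\lambda\in\mathcal{R}$, an $n\times n$ matrix over $\mathcal{R}$ is $\lambda$-circulant if each row after the first is obtained from the previous row $(x_1,x_2,\ldots,x_n)$ as $(\lambda x_n,x_1,\ldots,x_{n-1})$; so it is determined by its first row. The back diagonal matrix $R=(r_{ij})$ of order $n$ has $r_{i,n-i+1}=1$ and $r_{ij}=0$ if $j\ne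 n-i+1$. $I_k$ is the $k\times k$ identity matrix and $X^T$ the transpose of $X$. *)

theory Defs
  imports "Jordan_Normal_Form.VS_Connect" "HOL-Algebra.QuotRing"
begin

section \<open>Commutative Frobenius rings\<close>

text \<open>
  A commutative ring is Frobenius if it is Artinian and its quotient by the Jacobson radical is
  isomorphic, as a module over the ring, to its socle. A finite ring is Artinian, so for finite
  rings only the isomorphism is a condition.
\<close>

definition artinian_ring :: "('a, 'b) ring_scheme \<Rightarrow> bool" where
  "artinian_ring R \<longleftrightarrow>
     (\<forall>I :: nat \<Rightarrow> 'a set. (\<forall>k. ideal (I k) R \<and> I (Suc k) \<subseteq> I k) \<longrightarrow> (\<exists>N. \<forall>k\<ge>N. I k = I N))"

definition jacobson_radical :: "('a, 'b) ring_scheme \<Rightarrow> 'a set" where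
  "jacobson_radical R = carrier R \<inter> \<Inter>{I. maximalideal I R}"

definition minimal_ideal :: "('a, 'b) ring_scheme \<Rightarrow> 'a set \<Rightarrow> bool" where
  "minimal_ideal R I \<longleftrightarrow> ideal I R \<and> I \<noteq> {\<zero>\<^bsub>R\<^esub>} \<and>
     (\<forall>J. ideal J R \<and> J \<subseteq> I \<longrightarrow> J = {\<zero>\<^bsub>R\<^esub>} \<or> J = I)"

text \<open>The sum of all minimal ideals is the ideal generated by their union.\<close>

definition socle :: "('a, 'b) ring_scheme \<Rightarrow> 'a set" where
  "socle R = Idl\<^bsub>R\<^esub> (\<Union>{I. minimal_ideal R I})"

text \<open>
  An ideal and a quotient of \<open>R\<close>, viewed as modules over \<open>R\<close>. The fields \<open>mult\<close> and \<open>one\<close> of a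
  module record play no role.
\<close>

definition ideal_module :: "('a, 'b) ring_scheme \<Rightarrow> 'a set \<Rightarrow> ('a, 'a) module" where
  "ideal_module R I =
     \<lparr>carrier = I, monoid.mult = undefined, one = undefined, zero = \<zero>\<^bsub>R\<^esub>, add = add R,
      module.smult = (\<lambda>r x. r \<otimes>\<^bsub>R\<^esub> x)\<rparr>"

definition quotient_module :: "('a, 'b) ring_scheme \<Rightarrow> 'a set \<Rightarrow> ('a, 'a set) module" where
  "quotient_module R I =
     \<lparr>carrier = carrier (R Quot I), monoid.mult = undefined, one = undefined,
      zero = \<zero>\<^bsub>R Quot I\<^esub>, add = add (R Quot I),
      module.smult = (\<lambda>r X. (I +>\<^bsub>R\<^esub> r) \<otimes>\<^bsub>R Quot I\<^esub> X)\<rparr>"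

definition modules_isomorphic ::
  "('a, 'b) ring_scheme \<Rightarrow> ('a, 'c, 'd) module_scheme \<Rightarrow> ('a, 'e, 'f) module_scheme \<Rightarrow> bool" where
  "modules_isomorphic R M N \<longleftrightarrow>
     (\<exists>f \<in> LinearCombinations.module_hom R M N. bij_betw f (carrier M) (carrier N))"

definition commutative_frobenius_ring :: "('a, 'b) ring_scheme \<Rightarrow> bool" where
  "commutative_frobenius_ring R \<longleftrightarrow> cring R \<and> artinian_ring R \<and>
     modules_isomorphic R (quotient_module R (jacobson_radical R)) (ideal_module R (socle R))"


section \<open>Linear codes\<close>

definition linear_code :: "nat \<Rightarrow> 'a :: comm_ring_1 vec set \<Rightarrow> bool" where
  "linear_code m C \<longleftrightarrow> LinearCombinations.submodule class_ring C (module_vec TYPE('a) m)"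

definition dual_code :: "nat \<Rightarrow> 'a :: comm_ring_1 vec set \<Rightarrow> 'a vec set" where
  "dual_code m C = {x \<in> carrier_vec m. \<forall>y \<in> C. x \<bullet> y = 0}"

definition self_dual_code :: "nat \<Rightarrow> 'a :: comm_ring_1 vec set \<Rightarrow> bool" where
  "self_dual_code m C \<longleftrightarrow> linear_code m C \<and> C = dual_code m C"

definition generated_code :: "'a :: comm_ring_1 mat \<Rightarrow> 'a vec set" where
  "generated_code G =
     LinearCombinations.module.span class_ring (module_vec TYPE('a) (dim_col G)) (set (rows G))"


section \<open>Matrices\<close>

definition lambda_circulant_mat :: "nat \<Rightarrow> 'a :: comm_ring_1 \<Rightarrow> 'a mat \<Rightarrow> bool" where
  "lambda_circulant_mat n l A \<longleftrightarrow> A \<in> carrier_mat n n \<and>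
     (\<forall>i. Suc i < n \<longrightarrow>
        A $$ (Suc i, 0) = l * A $$ (i, n - 1) \<and>
        (\<forall>j. Suc j < n \<longrightarrow> A $$ (Suc i, Suc j) = A $$ (i, j)))"

text \<open>With indices starting at 0, the condition \<open>j = n - i + 1\<close> reads \<open>i + j + 1 = n\<close>.\<close>

definition back_diagonal_mat :: "nat \<Rightarrow> 'a :: comm_ring_1 mat" where
  "back_diagonal_mat n = mat n n (\<lambda>(i, j). if i + j + 1 = n then 1 else 0)"

definition append_cols :: "'a :: zero mat \<Rightarrow> 'a mat \<Rightarrow> 'a mat" where
  "append_cols A B = four_block_mat A B (0\<^sub>m 0 (dim_col A)) (0\<^sub>m 0 (dim_col B))"

definition generator_mat ::
  "nat \<Rightarrow> 'a :: comm_ring_1 mat \<Rightarrow> 'a mat \<Rightarrow> 'a mat \<Rightarrow> 'a mat \<Rightarrow> 'a mat" where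
  "generator_mat n A B C D =
     (let CR = C * back_diagonal_mat n; DR = D * back_diagonal_mat n in
      append_cols (1\<^sub>m (4 * n))
        (four_block_mat
           (four_block_mat A B
                           (- B) A)           (four_block_mat CR DR
                                                              DR (- CR))
           (four_block_mat (- CR) (- DR)
                           (- DR) CR)         (four_block_mat A B
                                                              (- B) A)))"

end

theory Submission
  imports Defs
begin

text \<open>
  A code generated by \<open>(I | M)\<close> with \<open>M M\<^sup>T = -I\<close> is contained in its dual, and it is all of it because
  \<open>M M\<^sup>T = -I\<close> forces \<open>M\<^sup>T M = -I\<close> over any commutative ring. For the matrix at hand the blocks
  of \<open>M M\<^sup>T\<close> reduce to the two given equations, except for mixed terms such as
  \<open>A R C\<^sup>T - C R A\<^sup>T\<close>, which vanish for \<open>\<lambda>\<close>-circulant matrices: the entry \<open>(i, j)\<close> of \<open>A R C\<^sup>T\<close>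
  depends only on \<open>i + j\<close> and the expression for it is symmetric under exchanging \<open>A\<close> with \<open>C\<close> and \<open>i\<close> with \<open>j\<close>.
\<close>

section \<open>The back diagonal matrix and \<lambda>-circulant matrices\<close>

lemma mult_back_diagonal_mat_index:
  fixes C :: "'a :: comm_ring_1 mat"
  assumes C: "C \<in> carrier_mat m n" and ik: "i < m" "k < n"
  shows "(C * back_diagonal_mat n) $$ (i, k) = C $$ (i, n - Suc k)"
proof -
  have "(C * back_diagonal_mat n) $$ (i, k) =
      (\<Sum>j\<in>{0..<n}. C $$ (i, j) * (if j + k + 1 = n then 1 else 0))"
    using C ik by (simp add: back_diagonal_mat_def scalar_prod_def)
  also have "\<dots> = (\<Sum>j\<in>{0..<n}. if n - Suc k = j then C $$ (i, j) else 0)"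
    using ik by (intro sum.cong) auto
  finally show ?thesis using ik by simp
qed

lemma lambda_circulant_reverse_product_commute:
  fixes A C :: "'a :: comm_ring_1 mat"
  assumes A: "lambda_circulant_mat n l A" and C: "lambda_circulant_mat n l C"
  shows "A * (C * back_diagonal_mat n)\<^sup>T = (C * back_diagonal_mat n) * A\<^sup>T"
proof -
  have cA: "A \<in> carrier_mat n n" and cC: "C \<in> carrier_mat n n"
    using A C by (auto simp: lambda_circulant_mat_def)
  \<comment> \<open>\<open>F i j\<close> is the entry \<open>(i, j)\<close> of \<open>A R C\<^sup>T\<close>, and \<open>F j i\<close> that of \<open>C R A\<^sup>T\<close>.\<close>
  define F where "F i j = (\<Sum>k<n. A $$ (i, k) * C $$ (j, n - Suc k))" for i j
  \<comment> \<open>Going to the next row wraps one entry around with factor \<open>l\<close>: in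
    \<open>A\<close> this affects the summand \<open>k = 0\<close>, in \<open>C\<close>, which is
    read backwards, the summand \<open>k = m\<close>. Both give
    \<open>l * A $$ (i, m) * C $$ (j, m)\<close>, and the remaining summands agree after an index
    shift.\<close>
  have step: "F (Suc i) j = F i (Suc j)" if ij: "Suc i < n" "Suc j < n" for i j
  proof -
    obtain m where n: "n = Suc m" using ij by (cases n) auto
    have "F (Suc i) j =
        l * A $$ (i, m) * C $$ (j, m) + (\<Sum>k<m. A $$ (i, k) * C $$ (j, m - Suc k))"
      using A ij unfolding F_def n sum.lessThan_Suc_shift
      by (auto simp: lambda_circulant_mat_def intro!: sum.cong)
    moreover have "F i (Suc j) =
        l * A $$ (i, m) * C $$ (j, m) + (\<Sum>k<m. A $$ (i, k) * C $$ (j, m - Suc k))"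
    proof -
      have "C $$ (Suc j, m - k) = C $$ (j, m - Suc k)" if "k < m" for k
      proof -
        from that have "m - k = Suc (m - Suc k)" "Suc (m - Suc k) < n" using n by auto
        then show ?thesis using C ij by (auto simp: lambda_circulant_mat_def)
      qed
      moreover have "C $$ (Suc j, 0) = l * C $$ (j, m)"
        using C ij n by (auto simp: lambda_circulant_mat_def)
      ultimately show ?thesis unfolding F_def n by (simp add: ac_simps)
    qed
    ultimately show ?thesis by simp
  qed
  have shift: "F (i + d) j = F i (j + d)" if "i + d < n" "j + d < n" for i j d
    using that
  proof (induction d arbitrary: j)
    case (Suc d)
    then show ?case using step[of "i + d" j] Suc.IH[of "Suc j"] by simp
  qed simp
  \<comment> \<open>Both indices start at the smaller of \<open>i\<close> and \<open>j\<close>; by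
    \<open>shift\<close> it does not matter which of them receives the difference.\<close>
  have sym: "F i j = F j i" if "i < n" "j < n" for i j
    using that shift[of i "j - i" i] shift[of j "i - j" j] by (cases "i \<le> j") auto
  define P where "P = C * back_diagonal_mat n"
  have P: "P \<in> carrier_mat n n" using cC by (simp add: P_def back_diagonal_mat_def)
  have P_index: "P $$ (i, k) = C $$ (i, n - Suc k)" if "i < n" "k < n" for i k
    unfolding P_def by (rule mult_back_diagonal_mat_index[OF cC that])
  have "A * P\<^sup>T = P * A\<^sup>T"
  proof (rule eq_matI)
    fix i j assume "i < dim_row (P * A\<^sup>T)" "j < dim_col (P * A\<^sup>T)"
    then have ij: "i < n" "j < n" using cA P by auto
    have "(A * P\<^sup>T) $$ (i, j) = F i j"
      using ij cA P P_index
      by (auto simp: scalar_prod_def F_def atLeast0LessThan intro!: sum.cong)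
    also have "\<dots> = F j i" by (rule sym[OF ij])
    also have "\<dots> = (P * A\<^sup>T) $$ (i, j)"
      using ij cA P P_index
      by (auto simp: scalar_prod_def F_def atLeast0LessThan mult.commute intro!: sum.cong)
    finally show "(A * P\<^sup>T) $$ (i, j) = (P * A\<^sup>T) $$ (i, j)" .
  qed (use cA P in auto)
  then show ?thesis by (simp only: P_def)
qed

text \<open>The back diagonal matrix is a symmetric permutation matrix, so its product with its
  transpose is the identity. On entries this is the reversal of the summation index.\<close>

lemma mult_back_diagonal_mat_transpose:
  fixes C D :: "'a :: comm_ring_1 mat"
  assumes C: "C \<in> carrier_mat n n" and D: "D \<in> carrier_mat n n"
  shows "(C * back_diagonal_mat n) * (D * back_diagonal_mat n)\<^sup>T = C * D\<^sup>T"
proof -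
  define P Q where "P = C * back_diagonal_mat n" and "Q = D * back_diagonal_mat n"
  have PQ: "P \<in> carrier_mat n n" "Q \<in> carrier_mat n n"
    using C D by (simp_all add: P_def Q_def back_diagonal_mat_def)
  have index: "P $$ (i, k) = C $$ (i, n - Suc k)" "Q $$ (i, k) = D $$ (i, n - Suc k)"
    if "i < n" "k < n" for i k
    unfolding P_def Q_def using C D that by (simp_all only: mult_back_diagonal_mat_index)
  have "P * Q\<^sup>T = C * D\<^sup>T"
  proof (rule eq_matI)
    fix i j assume "i < dim_row (C * D\<^sup>T)" "j < dim_col (C * D\<^sup>T)"
    then have ij: "i < n" "j < n" using C D by auto
    have "(P * Q\<^sup>T) $$ (i, j) = (\<Sum>k<n. C $$ (i, n - Suc k) * D $$ (j, n - Suc k))"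
      using ij PQ index by (auto simp: scalar_prod_def atLeast0LessThan intro!: sum.cong)
    also have "\<dots> = (\<Sum>k<n. C $$ (i, k) * D $$ (j, k))"
      by (rule sum.nat_diff_reindex)
    also have "\<dots> = (C * D\<^sup>T) $$ (i, j)"
      using ij C D by (simp add: scalar_prod_def atLeast0LessThan)
    finally show "(P * Q\<^sup>T) $$ (i, j) = (C * D\<^sup>T) $$ (i, j)" .
  qed (use C D PQ in auto)
  then show ?thesis by (simp only: P_def Q_def)
qed

section \<open>Skew block products and one-sided inverses\<close>

text \<open>Used at two levels: for the block built from \<open>A\<close> and \<open>B\<close>, and
  for the whole right half of the generator matrix, where the off-diagonal blocks vanish once
  \<open>X * Y\<^sup>T = Y * X\<^sup>T\<close>.\<close>

lemma mult_transpose_skew_four_block: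
  fixes X Y :: "'a :: comm_ring_1 mat"
  assumes X: "X \<in> carrier_mat m m" and Y: "Y \<in> carrier_mat m m"
  shows "four_block_mat X Y (- Y) X * (four_block_mat X Y (- Y) X)\<^sup>T =
    four_block_mat (X * X\<^sup>T + Y * Y\<^sup>T) (Y * X\<^sup>T - X * Y\<^sup>T) (X * Y\<^sup>T - Y * X\<^sup>T) (X * X\<^sup>T + Y * Y\<^sup>T)"
proof -
  have *: "- Y \<in> carrier_mat m m" "X\<^sup>T \<in> carrier_mat m m" "Y\<^sup>T \<in> carrier_mat m m" "(- Y)\<^sup>T \<in> carrier_mat m m"
    using X Y by auto
  show ?thesis
    using X Y *
    unfolding transpose_four_block_mat[OF X Y *(1) X]
      mult_four_block_mat[OF X Y *(1) X *(2) *(4) *(3) *(2)]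
    by (intro cong_four_block_mat eq_matI) (auto simp: transpose_uminus)
qed

text \<open>Determinants give \<open>det M * det (- N) = 1\<close>, so \<open>det (- N)\<close>
  times the adjugate of \<open>M\<close> is a left inverse of \<open>M\<close>. A left inverse
  equals any right inverse, here \<open>- N\<close>.\<close>

lemma mat_mult_uminus_one_commute:
  fixes M N :: "'a :: comm_ring_1 mat"
  assumes M: "M \<in> carrier_mat m m" and N: "N \<in> carrier_mat m m" and MN: "M * N = - 1\<^sub>m m"
  shows "N * M = - 1\<^sub>m m"
proof -
  define N' where "N' = - N"
  have N': "N' \<in> carrier_mat m m" using N by (simp add: N'_def)
  have MN': "M * N' = 1\<^sub>m m" using M N MN by (simp add: N'_def)
  then have "det M * det N' = 1" using det_mult[OF M N'] by simp
  let ?K = "det N' \<cdot>\<^sub>m adj_mat M"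
  note adj = adj_mat[OF M]
  have K: "?K \<in> carrier_mat m m" using adj by simp
  have KM: "?K * M = 1\<^sub>m m"
    using adj M \<open>det M * det N' = 1\<close>
    by (simp add: mult_smult_assoc_mat[of _ m m _ m]) (auto simp: mult.commute)
  have "?K = ?K * (M * N')" unfolding MN' by (rule right_mult_one_mat[OF K, symmetric])
  also have "\<dots> = N'" using K M N' KM by (simp flip: assoc_mult_mat)
  finally have "N' * M = 1\<^sub>m m" using KM by simp
  then have "- (N * M) = 1\<^sub>m m" using M N by (simp add: N'_def)
  then show ?thesis by (metis uminus_uminus_mat)
qed

section \<open>Generated codes, their duals, and the standard form\<close>

text \<open>Serves twice: it bounds the span of the rows from above, and it shows that the generated
  code is linear.\<close>

lemma submodule_range_mat:
  fixes N :: "'a :: comm_ring_1 mat"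
  assumes N: "N \<in> carrier_mat m k"
  shows "LinearCombinations.submodule class_ring {N *\<^sub>v y | y. y \<in> carrier_vec k} (module_vec TYPE('a) m)"
proof -
  interpret vec_module "TYPE('a)" m .
  show ?thesis
  proof (unfold_locales, goal_cases)
    case 1
    then show ?case using N by (auto simp: module_vec_simps)
  next
    case (2 v w)
    then obtain y z where "y \<in> carrier_vec k" "z \<in> carrier_vec k" "v = N *\<^sub>v y" "w = N *\<^sub>v z"
      by auto
    then show ?case using N
      by (auto simp: module_vec_simps mult_add_distrib_mat_vec intro!: exI[of _ "y + z"])
  next
    case 3
    then show ?case using N by (auto simp: module_vec_simps intro!: exI[of _ "0\<^sub>v k"])
  next
    case (4 c v)
    then obtain y where "y \<in> carrier_vec k" "v = N *\<^sub>v y" by auto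
    then show ?case using N
      by (auto simp: module_vec_simps mult_mat_vec intro!: exI[of _ "c \<cdot>\<^sub>v y"])
  qed
qed

lemma generated_code_eq_range_transpose:
  fixes G :: "'a :: comm_ring_1 mat"
  assumes G: "G \<in> carrier_mat k m"
  shows "generated_code G = {G\<^sup>T *\<^sub>v y | y. y \<in> carrier_vec k}"
proof -
  interpret vec_module "TYPE('a)" m .
  have code: "generated_code G = span (set (rows G))"
    using G by (simp add: generated_code_def)
  have rows: "set (rows G) \<subseteq> carrier_vec m" using G by (auto simp: rows_def)
  have cols: "mat_of_cols m (rows G) = G\<^sup>T" using G
    by (metis carrier_matD(2) cols_transpose index_transpose_mat(2) mat_of_cols_cols)
  have "span (set (rows G)) \<subseteq> {G\<^sup>T *\<^sub>v y | y. y \<in> carrier_vec k}"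
  proof (rule span_is_subset)
    show "set (rows G) \<subseteq> {G\<^sup>T *\<^sub>v y | y. y \<in> carrier_vec k}"
    proof
      fix r assume "r \<in> set (rows G)"
      then obtain i where "i < k" "r = row G i" using G by (auto simp: rows_def)
      then have "r = G\<^sup>T *\<^sub>v unit_vec k i" using G by (intro eq_vecI) auto
      then show "r \<in> {G\<^sup>T *\<^sub>v y | y. y \<in> carrier_vec k}" by auto
    qed
    show "LinearCombinations.submodule class_ring {G\<^sup>T *\<^sub>v y | y. y \<in> carrier_vec k} V"
      using G by (intro submodule_range_mat) simp
  qed
  moreover have "G\<^sup>T *\<^sub>v y \<in> span (set (rows G))" if "y \<in> carrier_vec k" for y
  proof -
    \<comment> \<open>The span is taken over the set of rows, so equal rows merge and their
      coefficients add up; \<open>mat_of_cols_mult_as_finsum\<close> supplies the resulting linear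
      combination.\<close>
    have "y \<in> carrier_vec (length (rows G))" "\<And>i. i < length (rows G) \<Longrightarrow> rows G ! i \<in> carrier_vec m"
      using that G by auto
    from mat_of_cols_mult_as_finsum[OF this] show ?thesis
      unfolding cols span_def by auto
  qed
  ultimately show ?thesis unfolding code by auto
qed

text \<open>\<open>G\<^sup>T\<close> is adjoint to \<open>G\<close> for the inner product, and a
  vector orthogonal to all unit vectors is zero. Thus \<open>G\<close> is a parity check matrix of
  the dual.\<close>

lemma dual_generated_code:
  fixes G :: "'a :: comm_ring_1 mat"
  assumes G: "G \<in> carrier_mat k m"
  shows "dual_code m (generated_code G) = {x \<in> carrier_vec m. G *\<^sub>v x = 0\<^sub>v k}"
proof -
  have *: "x \<bullet> (G\<^sup>T *\<^sub>v y) = (G *\<^sub>v x) \<bullet> y" if "x \<in> carrier_vec m" "y \<in> carrier_vec k" for x y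
    using transpose_vec_mult_scalar[OF G that] comm_scalar_prod[of x m "G\<^sup>T *\<^sub>v y"]
      comm_scalar_prod[of y k "G *\<^sub>v x"] G that by auto
  have "G *\<^sub>v x = 0\<^sub>v k" if x: "x \<in> carrier_vec m" and "\<forall>y \<in> carrier_vec k. (G *\<^sub>v x) \<bullet> y = 0" for x
  proof (rule eq_vecI)
    fix i assume "i < dim_vec (0\<^sub>v k :: 'a vec)"
    then have i: "i < k" by simp
    have "(G *\<^sub>v x) \<bullet> unit_vec k i = 0" using that by auto
    then show "(G *\<^sub>v x) $ i = 0\<^sub>v k $ i"
      using i G x scalar_prod_right_unit[of "i" k "G *\<^sub>v x"] by simp
  qed (use G in simp)
  moreover have "(\<forall>y \<in> generated_code G. x \<bullet> y = 0) \<longleftrightarrow> (\<forall>y \<in> carrier_vec k. (G *\<^sub>v x) \<bullet> y = 0)"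
    if "x \<in> carrier_vec m" for x
    unfolding generated_code_eq_range_transpose[OF G] using *[OF that] by force
  ultimately show ?thesis
    unfolding dual_code_def by fastforce
qed

lemma self_dual_code_standard_form:
  fixes M :: "'a :: comm_ring_1 mat"
  assumes M: "M \<in> carrier_mat m m" and MMT: "M * M\<^sup>T = - 1\<^sub>m m"
  shows "self_dual_code (m + m) (generated_code (append_cols (1\<^sub>m m) M))"
proof -
  let ?G = "append_cols (1\<^sub>m m) M"
  have G: "?G \<in> carrier_mat m (m + m)"
    using M unfolding append_cols_def by (metis add.right_neutral carrier_matD(2) four_block_carrier_mat index_one_mat(3) one_carrier_mat zero_carrier_mat)
  have MT: "M\<^sup>T \<in> carrier_mat m m" using M by simp
  have MTM: "M\<^sup>T * M = - 1\<^sub>m m" by (rule mat_mult_uminus_one_commute[OF M MT MMT])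
  have Gx: "?G *\<^sub>v (u @\<^sub>v v) = u + M *\<^sub>v v" if "u \<in> carrier_vec m" "v \<in> carrier_vec m" for u v
  proof -
    \<comment> \<open>\<open>append_cols\<close> is a block matrix whose lower blocks have no rows,
      so the block formula appends a vector of dimension 0.\<close>
    have "?G *\<^sub>v (u @\<^sub>v v) = (1\<^sub>m m *\<^sub>v u + M *\<^sub>v v) @\<^sub>v (0\<^sub>m 0 m *\<^sub>v u + 0\<^sub>m 0 m *\<^sub>v v)"
      unfolding append_cols_def using M that four_block_mat_mult_vec[of "1\<^sub>m m" m m M m "0\<^sub>m 0 m" 0 "0\<^sub>m 0 m" u v]
      by auto
    also have "\<dots> = u + M *\<^sub>v v" using M that by (intro eq_vecI) auto
    finally show ?thesis .
  qed
  have GTy: "?G\<^sup>T *\<^sub>v y = y @\<^sub>v M\<^sup>T *\<^sub>v y" if y: "y \<in> carrier_vec m" for y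
  proof -
    have "row ?G\<^sup>T i \<bullet> y = (y @\<^sub>v M\<^sup>T *\<^sub>v y) $ i" if "i < m + m" for i
    proof (cases "i < m")
      case True
      then have "col ?G i = unit_vec m i" using M by (auto simp: append_cols_def)
      then show ?thesis using True that G y by simp
    next
      case False
      then have "col ?G i = col M (i - m)" using that M by (auto simp: append_cols_def)
      then show ?thesis using False that G M y by simp
    qed
    then show ?thesis using G M y by (intro eq_vecI) auto
  qed
  have minus: "(- 1\<^sub>m m) *\<^sub>v y = - y" if "y \<in> carrier_vec m" for y :: "'a vec"
    using that by (intro eq_vecI) auto
  have "generated_code ?G \<subseteq> dual_code (m + m) (generated_code ?G)"
  proof -
    have "?G *\<^sub>v (?G\<^sup>T *\<^sub>v y) = 0\<^sub>v m" if y: "y \<in> carrier_vec m" for y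
    proof -
      have "?G *\<^sub>v (?G\<^sup>T *\<^sub>v y) = y + M *\<^sub>v (M\<^sup>T *\<^sub>v y)"
        using y M GTy Gx by simp
      also have "M *\<^sub>v (M\<^sup>T *\<^sub>v y) = - y"
        using y M MT MMT minus by (metis assoc_mult_mat_vec)
      finally show ?thesis using y by simp
    qed
    then show ?thesis
      unfolding dual_generated_code[OF G] unfolding generated_code_eq_range_transpose[OF G]
      using G by auto
  qed
  moreover have "x \<in> generated_code ?G" if "x \<in> dual_code (m + m) (generated_code ?G)" for x
  proof -
    have x: "x \<in> carrier_vec (m + m)" "?G *\<^sub>v x = 0\<^sub>v m"
      using that unfolding dual_generated_code[OF G] by auto
    define u v where "u = vec_first x m" and "v = vec_last x m"
    have uv: "u \<in> carrier_vec m" "v \<in> carrier_vec m" "x = u @\<^sub>v v"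
      using x(1) by (simp_all add: u_def v_def)
    have "u + M *\<^sub>v v = 0\<^sub>v m" using Gx uv x by simp
    then have "u $ i + (M *\<^sub>v v) $ i = 0" if "i < m" for i
      using that M by (metis carrier_matD(1) dim_mult_mat_vec index_add_vec(1) index_zero_vec(1))
    then have "u = - (M *\<^sub>v v)"
      using uv M by (intro eq_vecI) (auto simp: eq_neg_iff_add_eq_0 simp del: index_mult_mat_vec)
    \<comment> \<open>Here \<open>M\<^sup>T * M = - 1\<^sub>m m\<close> enters: it turns the
      right-hand side into \<open>v\<close>, so \<open>x\<close> is the codeword
      \<open>?G\<^sup>T *\<^sub>v u\<close>.\<close>
    then have "M\<^sup>T *\<^sub>v u = - (M\<^sup>T *\<^sub>v (M *\<^sub>v v))"
      using uv M by (intro eq_vecI) (auto simp: scalar_prod_uminus_right)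
    also have "\<dots> = v" using uv M MT MTM minus by (metis assoc_mult_mat_vec uminus_uminus_vec)
    finally show ?thesis
      unfolding generated_code_eq_range_transpose[OF G] using GTy[of u] uv by (auto intro!: exI[of _ u])
  qed
  moreover have "linear_code (m + m) (generated_code ?G)"
    unfolding linear_code_def generated_code_eq_range_transpose[OF G]
    using G by (intro submodule_range_mat) simp
  ultimately show ?thesis unfolding self_dual_code_def by auto
qed

section \<open>The blocks containing the back diagonal matrix\<close>

text \<open>Compared with the skew pattern, the off-diagonal blocks change sign. This accounts for
  the opposite signs of the \<open>A\<close>, \<open>B\<close> terms and the \<open>C\<close>,
  \<open>D\<close> terms in the second matrix equation.\<close>

lemma mult_transpose_four_block_self_adjoint:
  fixes P Q :: "'a :: comm_ring_1 mat"
  assumes P: "P \<in> carrier_mat n n" and Q: "Q \<in> carrier_mat n n"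
  shows "four_block_mat P Q Q (- P) * (four_block_mat P Q Q (- P))\<^sup>T =
    four_block_mat (P * P\<^sup>T + Q * Q\<^sup>T) (P * Q\<^sup>T - Q * P\<^sup>T) (Q * P\<^sup>T - P * Q\<^sup>T) (P * P\<^sup>T + Q * Q\<^sup>T)"
proof -
  have *: "- P \<in> carrier_mat n n" "P\<^sup>T \<in> carrier_mat n n" "Q\<^sup>T \<in> carrier_mat n n" "(- P)\<^sup>T \<in> carrier_mat n n"
    using P Q by auto
  show ?thesis
    using P Q *
    unfolding transpose_four_block_mat[OF P Q Q *(1)]
      mult_four_block_mat[OF P Q Q *(1) *(2) *(3) *(3) *(4)]
    by (intro cong_four_block_mat eq_matI) (auto simp: transpose_uminus)
qed

text \<open>After multiplying out, the four assumed identities match the blocks term by term, up to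
  the order of the summands.\<close>

lemma mult_transpose_mixed_four_block:
  fixes A B P Q :: "'a :: comm_ring_1 mat"
  assumes A: "A \<in> carrier_mat n n" and B: "B \<in> carrier_mat n n"
    and P: "P \<in> carrier_mat n n" and Q: "Q \<in> carrier_mat n n"
    and AP: "A * P\<^sup>T = P * A\<^sup>T" and AQ: "A * Q\<^sup>T = Q * A\<^sup>T"
    and BP: "B * P\<^sup>T = P * B\<^sup>T" and BQ: "B * Q\<^sup>T = Q * B\<^sup>T"
  shows "four_block_mat A B (- B) A * (four_block_mat P Q Q (- P))\<^sup>T =
    four_block_mat P Q Q (- P) * (four_block_mat A B (- B) A)\<^sup>T"
proof -
  have *: "- P \<in> carrier_mat n n" "P\<^sup>T \<in> carrier_mat n n" "Q\<^sup>T \<in> carrier_mat n n" "(- P)\<^sup>T \<in> carrier_mat n n"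
    "- B \<in> carrier_mat n n" "A\<^sup>T \<in> carrier_mat n n" "B\<^sup>T \<in> carrier_mat n n" "(- B)\<^sup>T \<in> carrier_mat n n"
    using A B P Q by auto
  show ?thesis
    unfolding transpose_four_block_mat[OF P Q Q *(1)] transpose_four_block_mat[OF A B *(5) A]
      mult_four_block_mat[OF A B *(5) A *(2) *(3) *(3) *(4)]
      mult_four_block_mat[OF P Q Q *(1) *(6) *(8) *(7) *(6)]
    using A B P Q * AP AQ BP BQ
    by (intro cong_four_block_mat) (auto simp: transpose_uminus comm_add_mat[of _ n n])
qed

section \<open>Self-duality of the code with the given generator matrix\<close>

theorem theorem3p2:
  fixes A B C D :: "'a :: comm_ring_1 mat" and l :: 'a and n :: nat
  assumes "commutative_frobenius_ring (class_ring :: 'a ring)"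
    and "n \<ge> 1"
    and "lambda_circulant_mat n l A" "lambda_circulant_mat n l B" 
      "lambda_circulant_mat n l C" "lambda_circulant_mat n l D"
    and "A * A\<^sup>T + B * B\<^sup>T + C * C\<^sup>T + D * D\<^sup>T = - 1\<^sub>m n"
    and "A * B\<^sup>T - B * A\<^sup>T - C * D\<^sup>T + D * C\<^sup>T = 0\<^sub>m n n"
  shows "self_dual_code (8 * n) (generated_code (generator_mat n A B C D))"
proof -
  define P Q where "P = C * back_diagonal_mat n" and "Q = D * back_diagonal_mat n"
  \<comment> \<open>The 4 by 4 block pattern is a 2 by 2 skew pattern in the larger blocks
    \<open>X\<close> and \<open>Y\<close>.\<close>
  define X Y where "X = four_block_mat A B (- B) A" and "Y = four_block_mat P Q Q (- P)"
  define M where "M = four_block_mat X Y (- Y) X"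
  have car: "A \<in> carrier_mat n n" "B \<in> carrier_mat n n" "C \<in> carrier_mat n n" "D \<in> carrier_mat n n"
    using assms(3-6) by (auto simp: lambda_circulant_mat_def)
  then have PQ: "P \<in> carrier_mat n n" "Q \<in> carrier_mat n n"
    by (auto simp: P_def Q_def back_diagonal_mat_def)
  have XY: "X \<in> carrier_mat (n + n) (n + n)" "Y \<in> carrier_mat (n + n) (n + n)"
    using car PQ by (simp_all add: X_def Y_def)
  then have M: "M \<in> carrier_mat ((n + n) + (n + n)) ((n + n) + (n + n))"
    by (simp add: M_def)
  have PQT: "P * P\<^sup>T = C * C\<^sup>T" "Q * Q\<^sup>T = D * D\<^sup>T" "P * Q\<^sup>T = C * D\<^sup>T" "Q * P\<^sup>T = D * C\<^sup>T"
    using car by (simp_all add: P_def Q_def mult_back_diagonal_mat_transpose)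
  have e1: "(A * A\<^sup>T) $$ (i, j) + (B * B\<^sup>T) $$ (i, j) + (C * C\<^sup>T) $$ (i, j) + (D * D\<^sup>T) $$ (i, j) =
      (- 1\<^sub>m n) $$ (i, j)" if "i < n" "j < n" for i j
    unfolding assms(7)[symmetric] using car that by simp
  have e2: "(A * B\<^sup>T) $$ (i, j) - (B * A\<^sup>T) $$ (i, j) - (C * D\<^sup>T) $$ (i, j) + (D * C\<^sup>T) $$ (i, j) = 0"
    if "i < n" "j < n" for i j
    using arg_cong[OF assms(8), of "\<lambda>W. W $$ (i, j)"] car that by simp
  have "X * X\<^sup>T + Y * Y\<^sup>T = - 1\<^sub>m (n + n)"
    unfolding X_def Y_def mult_transpose_skew_four_block[OF car(1,2)]
      mult_transpose_four_block_self_adjoint[OF PQ] PQT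
  proof (rule eq_matI, goal_cases)
    case (1 i j)
    \<comment> \<open>The cases are the four blocks: \<open>e1\<close> settles the diagonal ones,
      \<open>e2\<close> the off-diagonal ones. The last fact identifies the entries of the identity
      matrix in the lower right block.\<close>
    then have "i < n \<or> n \<le> i \<and> i - n < n" "j < n \<or> n \<le> j \<and> j - n < n"
      "\<lbrakk>n \<le> i; n \<le> j\<rbrakk> \<Longrightarrow> i - n = j - n \<longleftrightarrow> i = j" by auto
    then show ?case
      using 1 car e1[of i j] e1[of "i - n" "j - n"] e2[of i "j - n"] e2[of "i - n" j]
      by (elim disjE conjE) (simp_all add: algebra_simps del: index_mult_mat(1))
  qed (use car in auto)
  moreover have "X * Y\<^sup>T = Y * X\<^sup>T"
    unfolding X_def Y_def using car PQ
    by (intro mult_transpose_mixed_four_block)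
      (simp_all only: P_def Q_def lambda_circulant_reverse_product_commute[OF assms(3) assms(5)]
        lambda_circulant_reverse_product_commute[OF assms(3) assms(6)]
        lambda_circulant_reverse_product_commute[OF assms(4) assms(5)]
        lambda_circulant_reverse_product_commute[OF assms(4) assms(6)])
  moreover have "Y * X\<^sup>T \<in> carrier_mat (n + n) (n + n)" using XY by simp
  ultimately have "M * M\<^sup>T =
      four_block_mat (- 1\<^sub>m (n + n)) (0\<^sub>m (n + n) (n + n)) (0\<^sub>m (n + n) (n + n)) (- 1\<^sub>m (n + n))"
    unfolding M_def mult_transpose_skew_four_block[OF XY] by simp
  also have "\<dots> = - 1\<^sub>m ((n + n) + (n + n))" by (rule eq_matI) auto
  finally have "self_dual_code ((n + n) + (n + n) + ((n + n) + (n + n)))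
      (generated_code (append_cols (1\<^sub>m ((n + n) + (n + n))) M))"
    by (rule self_dual_code_standard_form[OF M])
  \<comment> \<open>\<open>generator_mat\<close> has the signs inside the small blocks, so the
    negation is distributed before comparing with \<open>M\<close>.\<close>
  moreover have "- Y = four_block_mat (- P) (- Q) (- Q) P"
    unfolding Y_def using PQ by (intro eq_matI) auto
  then have "generator_mat n A B C D = append_cols (1\<^sub>m (4 * n)) M"
    by (simp add: generator_mat_def Let_def M_def X_def Y_def P_def Q_def)
  moreover have "(n + n) + (n + n) = 4 * n" "4 * n + 4 * n = 8 * n" by simp_all
  ultimately show ?thesis by (simp only:)
qed

end
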